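(* The Petersen graph (the graph whose vertices are the $2$-element subsets of a $5$-element set, two vertices being adjacent if and only if the subsets are disjoint) is not $(2,3)$-orientable.
   Context: $\overrightarrow{uv}$ denotes an arc going from $u$ to $v$. A labeling $f:V\to\{0,1\}$ of a finite vertex set is friendly if it is surjective and $\big||f^{-1}(0)|-|f^{-1}(1)|\big|\le 1$. Given a digraph $D=(V,A)$ without directed $2$-cycles and a labeling $f:V\to\{0,1\}$, the induced arc labeling is $g:A\to\{-1,0,1\}$, $g(\overrightarrow{uv})=f(v)-f(u)$. $D$ is $(2,3)$-cordial if there is a friendly labeling $f$ of $V$ whose induced arc labeling $g$ satisfies $-1\le |g^{-1}(i)|-|g^{-1}(j)|\le 1$ for all $i,j\in\{-1,0,1\}$. An orientation of a simple undirected connected graph $G$ is a digraph on the same vertex set obtained by replacing each edge $\{u,v\}$ of $G$ by exactly one of the arcs $\overrightarrow{uv}$, $\overrightarrow{vu}$ (and having no other arcs). $G$ is $(2,3)$-orientable if there exists an orientation of $G$ that is $(2,3)$-cordial. *)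

theory Defs
  imports "Graph_Theory.Graph_Theory"
begin

text \<open>
  As usual in \<^theory>\<open>Graph_Theory.Graph_Theory\<close>, a simple undirected graph \<open>G\<close> is a
  \<^locale>\<open>pair_graph\<close>: the edge \<open>{u, v}\<close> is represented by the two pairs \<open>(u, v)\<close> and \<open>(v, u)\<close>.
  In a digraph, \<open>(u, v)\<close> is the arc from \<open>u\<close> to \<open>v\<close>.

  The definitions below are meant for finite vertex sets, digraphs without directed 2-cycles
  and connected simple graphs; these conditions are not built into them. They hold
  for the Petersen graph and its orientations by the lemmas at the end of this theory.
\<close>

text \<open>
  A labeling of \<open>V\<close> is an integer-valued function, so that differences of labels make
  sense; only its values on \<open>V\<close> matter. The equation for the image says that it maps \<open>V\<close> into
  \<open>{0, 1}\<close> and is surjective.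
\<close>

definition friendly_labeling :: "'a set \<Rightarrow> ('a \<Rightarrow> int) \<Rightarrow> bool" where
  "friendly_labeling V f \<longleftrightarrow>
     f ` V = {0, 1} \<and>
     \<bar>int (card {v \<in> V. f v = 0}) - int (card {v \<in> V. f v = 1})\<bar> \<le> 1"

definition arc_labeling :: "('a \<Rightarrow> int) \<Rightarrow> 'a \<times> 'a \<Rightarrow> int" where
  "arc_labeling f = (\<lambda>(u, v). f v - f u)"

definition two_three_cordial :: "'a pair_pre_digraph \<Rightarrow> bool" where
  "two_three_cordial D \<longleftrightarrow>
     (\<exists>f. friendly_labeling (pverts D) f \<and>
        (\<forall>i \<in> {-1, 0, 1}. \<forall>j \<in> {-1, 0, 1}.
           -1 \<le> int (card {a \<in> parcs D. arc_labeling f a = i})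
                 - int (card {a \<in> parcs D. arc_labeling f a = j}) \<and>
           int (card {a \<in> parcs D. arc_labeling f a = i})
                 - int (card {a \<in> parcs D. arc_labeling f a = j}) \<le> 1))"

definition orientation_of :: "'a pair_pre_digraph \<Rightarrow> 'a pair_pre_digraph \<Rightarrow> bool" where
  "orientation_of D G \<longleftrightarrow>
     pverts D = pverts G \<and>
     parcs D \<subseteq> parcs G \<and>
     (\<forall>(u, v) \<in> parcs G. ((u, v) \<in> parcs D) \<noteq> ((v, u) \<in> parcs D))"

definition two_three_orientable :: "'a pair_pre_digraph \<Rightarrow> bool" where
  "two_three_orientable G \<longleftrightarrow> (\<exists>D. orientation_of D G \<and> two_three_cordial D)"

text \<open>This is the Petersen graph when \<open>X\<close> is a 5-element set.\<close>

definition petersen_graph :: "'a set \<Rightarrow> 'a set pair_pre_digraph" where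
  "petersen_graph X =
     \<lparr>pverts = {S. S \<subseteq> X \<and> card S = 2},
      parcs = {(S, T). S \<subseteq> X \<and> card S = 2 \<and> T \<subseteq> X \<and> card T = 2 \<and> S \<inter> T = {}}\<rparr>"

lemma orientation_of_no_2_cycle:
  assumes "orientation_of D G" "(u, v) \<in> parcs D"
  shows "(v, u) \<notin> parcs D"
  using assms by (auto simp: orientation_of_def)

lemma pair_graph_petersen_graph:
  assumes "card X = 5"
  shows "pair_graph (petersen_graph X)"
proof -
  have "finite X" using assms by (metis card.infinite zero_neq_numeral)
  then have fin: "finite (pverts (petersen_graph X))"
    by (auto simp: petersen_graph_def)
  have "parcs (petersen_graph X) \<subseteq> pverts (petersen_graph X) \<times> pverts (petersen_graph X)"
    by (auto simp: petersen_graph_def)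
  then have fin': "finite (parcs (petersen_graph X))"
    using fin by (meson finite_SigmaI finite_subset)
  show ?thesis
    by unfold_locales
      (use fin fin' in \<open>auto simp: petersen_graph_def symmetric_def arcs_ends_conv sym_def\<close>)
qed

lemma connected_petersen_graph:
  assumes "card X = 5"
  shows "connected (with_proj (petersen_graph X))"
proof -
  let ?G = "petersen_graph X"
  interpret pair_graph ?G using assms by (rule pair_graph_petersen_graph)
  have finX: "finite X" using assms by (metis card.infinite zero_neq_numeral)
  have adj: "S \<rightarrow>\<^sup>*\<^bsub>with_proj ?G\<^esub> T"
    if "S \<subseteq> X" "card S = 2" "T \<subseteq> X" "card T = 2" "S \<inter> T = {}" for S T
    using that by (intro reachable_adjI) (auto simp: petersen_graph_def)
  have reach: "S \<rightarrow>\<^sup>*\<^bsub>with_proj ?G\<^esub> T"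
    if S: "S \<subseteq> X" "card S = 2" and T: "T \<subseteq> X" "card T = 2" for S T
  proof -
    consider "S = T" | "S \<inter> T = {}" | "S \<noteq> T" "S \<inter> T \<noteq> {}" by blast
    then show ?thesis
    proof cases
      case 1
      have "S \<in> pverts ?G" using S by (simp add: petersen_graph_def)
      then show ?thesis using 1 reachable_refl by metis
    next
      case 2
      then show ?thesis using adj S T by blast
    next
      case 3
      have fin: "finite S" "finite T" using S T finX finite_subset by blast+
      have "card (S \<inter> T) \<noteq> 2"
        using 3 S T fin by (metis card_subset_eq inf_le1 inf_le2)
      moreover have "card (S \<inter> T) \<noteq> 0" using 3 fin by simp
      moreover have "card (S \<inter> T) \<le> 2" using S fin by (metis card_mono inf_le1)
      ultimately have "card (S \<inter> T) = 1" by linarith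
      then have "card (S \<union> T) = 3" using card_Un_Int[OF fin] S T by simp
      then have "card (X - (S \<union> T)) = 2"
        using assms S T fin by (simp add: card_Diff_subset)
      then have "S \<rightarrow>\<^sup>*\<^bsub>with_proj ?G\<^esub> (X - (S \<union> T))"
        and "(X - (S \<union> T)) \<rightarrow>\<^sup>*\<^bsub>with_proj ?G\<^esub> T"
        using S T by (intro adj; blast)+
      then show ?thesis by (rule reachable_trans)
    qed
  qed
  obtain S where "S \<subseteq> X" "card S = 2" using obtain_subset_with_card_n[of 2 X] assms by auto
  then have "verts (with_proj ?G) \<noteq> {}" by (auto simp: petersen_graph_def)
  moreover have "S \<rightarrow>\<^sup>*\<^bsub>with_proj ?G\<^esub> T"
    if "S \<in> verts (with_proj ?G)" "T \<in> verts (with_proj ?G)" for S T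
    using reach[of S T] that by (simp add: petersen_graph_def)
  ultimately show ?thesis
    unfolding connected_def
    by (intro strongly_connectedI reachable_mk_symmetricI) simp_all
qed

end

theory Submission
  imports Defs
begin

text \<open>
  The obstruction is one of parity. The Petersen graph is cubic on \<open>10\<close> vertices, so an
  orientation has \<open>15\<close> arcs, and in a cordial one the arc labels \<open>-1\<close>, \<open>0\<close>, \<open>1\<close> must occur exactly
  \<open>5\<close> times each. Hence the differences \<open>f v - f u\<close> over all arcs \<open>(u, v)\<close> add up to \<open>0\<close>. Adding
  \<open>f u + f v\<close> instead changes the total by an even number, but by the handshake argument this total
  counts every vertex labeled \<open>1\<close> three times. A friendly labeling has \<open>5\<close> such vertices, so the
  total is \<open>15\<close>, which is odd.

  The same reasoning rules out every \<open>d\<close>-regular graph on \<open>2 * k\<close> vertices with \<open>d\<close> and \<open>k\<close> odd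
  and \<open>3\<close> dividing \<open>d * k\<close>; this is \<open>regular_graph_not_two_three_orientable\<close>.
\<close>

text \<open>
  The handshake argument with weights: the arc of the orientation that replaces an edge accounts
  for both directions of that edge, hence for both of its end points.
\<close>

lemma (in pair_graph) sum_orientation_end_points:
  fixes h :: "'a \<Rightarrow> int"
  assumes "orientation_of D G"
  shows "(\<Sum>(u, v)\<in>parcs D. h u + h v) = (\<Sum>u\<in>pverts G. int (card {v. (u, v) \<in> parcs G}) * h u)"
proof -
  have sym: "(v, u) \<in> parcs G" if "(u, v) \<in> parcs G" for u v
    using that by (rule arcs_symmetric)
  have sub: "parcs D \<subseteq> parcs G"
    and one: "\<And>u v. (u, v) \<in> parcs G \<Longrightarrow> ((u, v) \<in> parcs D) \<noteq> ((v, u) \<in> parcs D)"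
    using assms by (auto simp: orientation_of_def)
  have split: "parcs G = parcs D \<union> (parcs D)\<inverse>" and disj: "parcs D \<inter> (parcs D)\<inverse> = {}"
    using sub one sym by fast+
  have fin: "finite (parcs D)"
    using sub pair_finite_arcs by (rule finite_subset)
  have rows: "parcs G = (SIGMA u:pverts G. {v. (u, v) \<in> parcs G})"
    by (auto dest: in_arcsD1)
  have fin_row: "finite {v. (u, v) \<in> parcs G}" for u
    by (rule finite_subset[of _ "snd ` parcs G"]) force+
  have "(\<Sum>(u, v)\<in>parcs D. h u + h v) = (\<Sum>(u, v)\<in>parcs D. h u) + (\<Sum>(u, v)\<in>parcs D. h v)"
    by (simp add: case_prod_unfold sum.distrib)
  also have "(\<Sum>(u, v)\<in>parcs D. h v) = (\<Sum>(u, v)\<in>(parcs D)\<inverse>. h u)"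
    by (rule sum.reindex_bij_witness[of _ prod.swap prod.swap]) auto
  also have "(\<Sum>(u, v)\<in>parcs D. h u) + (\<Sum>(u, v)\<in>(parcs D)\<inverse>. h u) = (\<Sum>(u, v)\<in>parcs G. h u)"
    unfolding split using fin disj by (simp add: sum.union_disjoint)
  also have "\<dots> = (\<Sum>u\<in>pverts G. \<Sum>v\<in>{v. (u, v) \<in> parcs G}. h u)"
    by (subst rows, subst sum.Sigma) (use fin_row in auto)
  finally show ?thesis by simp
qed

lemma (in pair_graph) card_orientation_regular:
  assumes "orientation_of D G"
    and "\<And>u. u \<in> pverts G \<Longrightarrow> card {v. (u, v) \<in> parcs G} = d"
  shows "2 * card (parcs D) = d * card (pverts G)"
proof -
  have "int (2 * card (parcs D)) = int (d * card (pverts G))"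
    using sum_orientation_end_points[OF assms(1), of "\<lambda>_. 1"] assms(2)
    by (simp add: case_prod_unfold mult.commute)
  then show ?thesis by (simp only: of_nat_eq_iff)
qed

lemma friendly_labeling_sum:
  assumes "friendly_labeling V f" and "card V = 2 * k"
  shows "(\<Sum>v\<in>V. f v) = int k"
proof -
  have img: "f ` V = {0, 1}"
    and bal: "\<bar>int (card {v \<in> V. f v = 0}) - int (card {v \<in> V. f v = 1})\<bar> \<le> 1"
    using assms(1) by (simp_all add: friendly_labeling_def)
  show ?thesis
  proof (cases "finite V")
    case True
    have "V = {v \<in> V. f v = 0} \<union> {v \<in> V. f v = 1}"
      using img by auto
    then have "card V = card ({v \<in> V. f v = 0} \<union> {v \<in> V. f v = 1})"
      by simp
    also have "\<dots> = card {v \<in> V. f v = 0} + card {v \<in> V. f v = 1}"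
      using True by (intro card_Un_disjoint) auto
    finally have "card {v \<in> V. f v = 1} = k"
      using bal assms(2) by linarith
    moreover have "(\<Sum>v\<in>V. f v) = (\<Sum>v\<in>V. if f v = 1 then 1 else 0)"
      using img by (intro sum.cong) auto
    ultimately show ?thesis
      using True by (simp add: sum.If_cases Int_def)
  next
    case False
    then show ?thesis using assms(2) by simp
  qed
qed

text \<open>
  Three numbers that pairwise differ by at most \<open>1\<close> and have a sum divisible by \<open>3\<close> are equal.
  In particular the labels \<open>-1\<close> and \<open>1\<close> occur equally often and cancel.
\<close>

lemma cordial_sum_arc_labeling:
  assumes "finite A" and "3 dvd card A"
    and labels: "\<And>a. a \<in> A \<Longrightarrow> g a \<in> {-1, 0, 1 :: int}"
    and bal: "\<And>i j. i \<in> {-1, 0, 1} \<Longrightarrow> j \<in> {-1, 0, 1} \<Longrightarrow>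
      int (card {a \<in> A. g a = i}) - int (card {a \<in> A. g a = j}) \<le> 1"
  shows "(\<Sum>a\<in>A. g a) = 0"
proof -
  define n where "n i = card {a \<in> A. g a = i}" for i
  have fin: "finite {a \<in> A. g a = i}" for i
    using assms(1) by simp
  have "A = {a \<in> A. g a = -1} \<union> {a \<in> A. g a = 0} \<union> {a \<in> A. g a = 1}"
    using labels by auto
  then have "card A = card ({a \<in> A. g a = -1} \<union> {a \<in> A. g a = 0} \<union> {a \<in> A. g a = 1})"
    by simp
  also have "\<dots> = n (-1) + n 0 + n 1"
    unfolding n_def using fin by (subst card_Un_disjoint; auto)+
  finally have "3 dvd n (-1) + n 0 + n 1"
    using assms(2) by simp
  moreover have "int (n i) - int (n j) \<le> 1" if "i \<in> {-1, 0, 1}" "j \<in> {-1, 0, 1}" for i j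
    using bal[OF that] by (simp add: n_def)
  from this[of "-1" 0] this[of 0 "-1"] this[of "-1" 1] this[of 1 "-1"] this[of 0 1] this[of 1 0]
  have "int (n (-1)) - int (n 0) \<le> 1" "int (n 0) - int (n (-1)) \<le> 1"
    "int (n (-1)) - int (n 1) \<le> 1" "int (n 1) - int (n (-1)) \<le> 1"
    "int (n 0) - int (n 1) \<le> 1" "int (n 1) - int (n 0) \<le> 1"
    by simp_all
  ultimately have "n 1 = n (-1)" by presburger
  moreover have "(\<Sum>a\<in>A. g a) = (\<Sum>a\<in>A. (if g a = 1 then 1 else 0) - (if g a = -1 then 1 else 0))"
    using labels by (intro sum.cong) auto
  then have "(\<Sum>a\<in>A. g a) = int (n 1) - int (n (-1))"
    using assms(1) by (simp add: sum_subtractf sum.If_cases Int_def n_def)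
  ultimately show ?thesis by simp
qed

text \<open>
  The sum of \<open>f u + f v\<close> over the arcs is \<open>d * k\<close>, which is odd, while the sum of \<open>f v - f u\<close> is
  \<open>0\<close>; the two sums must have the same parity.
\<close>

lemma (in pair_graph) regular_graph_not_two_three_orientable:
  assumes reg: "\<And>u. u \<in> pverts G \<Longrightarrow> card {v. (u, v) \<in> parcs G} = d"
    and card: "card (pverts G) = 2 * k"
    and "odd d" "odd k" "3 dvd d * k"
  shows "\<not> two_three_orientable G"
proof
  assume "two_three_orientable G"
  then obtain D f where D: "orientation_of D G" and f: "friendly_labeling (pverts D) f"
    and bal: "\<And>i j. i \<in> {-1, 0, 1} \<Longrightarrow> j \<in> {-1, 0, 1} \<Longrightarrow>
      int (card {a \<in> parcs D. arc_labeling f a = i})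
        - int (card {a \<in> parcs D. arc_labeling f a = j}) \<le> 1"
    unfolding two_three_orientable_def two_three_cordial_def by blast
  have verts: "pverts D = pverts G" and sub: "parcs D \<subseteq> parcs G"
    using D by (simp_all add: orientation_of_def)
  have fin: "finite (parcs D)"
    using sub pair_finite_arcs by (rule finite_subset)
  have "card (parcs D) = d * k"
    using card_orientation_regular[OF D reg] card by simp
  moreover have "arc_labeling f a \<in> {-1, 0, 1}" if "a \<in> parcs D" for a
  proof -
    obtain u v where a: "a = (u, v)" by force
    have "u \<in> pverts D" "v \<in> pverts D"
      using that a sub verts wellformed by fastforce+
    then have "f u \<in> {0, 1}" "f v \<in> {0, 1}"
      using f unfolding friendly_labeling_def by blast+
    then show ?thesis
      using a by (auto simp: arc_labeling_def)
  qed
  ultimately have "(\<Sum>a\<in>parcs D. arc_labeling f a) = 0"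
    using fin bal \<open>3 dvd d * k\<close> by (intro cordial_sum_arc_labeling) simp_all
  then have "(\<Sum>(u, v)\<in>parcs D. f u + f v)
      = (\<Sum>(u, v)\<in>parcs D. f u + f v) - (\<Sum>a\<in>parcs D. arc_labeling f a)"
    by simp
  also have "\<dots> = 2 * (\<Sum>(u, v)\<in>parcs D. f u)"
    unfolding sum_subtractf[symmetric] sum_distrib_left
    by (intro sum.cong) (auto simp: arc_labeling_def)
  finally have "even (\<Sum>(u, v)\<in>parcs D. f u + f v)"
    by simp
  moreover have "(\<Sum>(u, v)\<in>parcs D. f u + f v) = int d * (\<Sum>u\<in>pverts G. f u)"
    using sum_orientation_end_points[OF D, of f] reg by (simp add: sum_distrib_left)
  ultimately show False
    using friendly_labeling_sum[of "pverts G" f k] f card verts \<open>odd d\<close> \<open>odd k\<close> by simp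
qed

lemma petersen_graph_cubic:
  assumes "card X = 5" and "S \<in> pverts (petersen_graph X)"
  shows "card {T. (S, T) \<in> parcs (petersen_graph X)} = 3"
proof -
  have fin: "finite X"
    using assms(1) by (metis card.infinite zero_neq_numeral)
  have S: "S \<subseteq> X" "card S = 2"
    using assms(2) by (auto simp: petersen_graph_def)
  have "{T. (S, T) \<in> parcs (petersen_graph X)} = {T. T \<subseteq> X - S \<and> card T = 2}"
    using S by (auto simp: petersen_graph_def)
  moreover have "card (X - S) = 3"
    using assms(1) S fin by (simp add: card_Diff_subset finite_subset)
  ultimately show ?thesis
    using fin by (simp add: n_subsets choose_two)
qed

lemma card_pverts_petersen_graph:
  assumes "card X = 5"
  shows "card (pverts (petersen_graph X)) = 10"
proof -
  have "finite X"
    using assms by (metis card.infinite zero_neq_numeral)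
  then show ?thesis
    using assms by (simp add: petersen_graph_def n_subsets choose_two)
qed

theorem theorem4p1:
  fixes X :: "'a set"
  assumes "card X = 5"
  shows "\<not> two_three_orientable (petersen_graph X)"
proof -
  interpret pair_graph "petersen_graph X"
    using assms by (rule pair_graph_petersen_graph)
  show ?thesis
    using petersen_graph_cubic[OF assms] card_pverts_petersen_graph[OF assms]
    by (intro regular_graph_not_two_three_orientable[where d = 3 and k = 5]) simp_all
qed

end
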